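(* Let $F\in\mathcal F_1(I)$ be strictly increasing. Then there is a map $\kappa_F:\{0,1,\dots,m\}\to\{1,\dots,m\}$ such that for every $i\in\{0,1,\dots,m\}$ there exists $K\in\Lambda(F)$ satisfying: (i) $F^{\kappa_F(i)}(I_i)\subset K$; (ii) $F^{k}(I_i)\not\subset K$ for $1\le k\le \kappa_F(i)-1$; (iii) $F^{p}(I_i)\cap F^{q}(I_i)=\emptyset$ for $1\le p\neq q\le\kappa_F(i)$.
   Context: Let $I=[a,b]\subset\mathbb R$, $a<b$. A multifunction $F:I\to 2^I$ assigns to each $x\in I$ a nonempty subset $F(x)\subset I$ (singletons are identified with their elements); $F(A)=\bigcup_{x\in A}F(x)$, $(G\circ F)(x)=G(F(x))$, $F^0(x)=\{x\}$, $F^n=F\circ F^{n-1}$. $F$ is upper semi-continuous (usc) at $x_0\in I$ if for every open $V\subset\mathbb R$ with $F(x_0)\subset V$ there is a neighborhood $U$ of $x_0$ such that $F(x)\subset V$ for all $x\in U\cap I$; usc means usc at every point. $F$ is strictly increasing (resp. strictly decreasing) if $\max F(x)<\min F(y)$ (resp. $\min F(x)>\max F(y)$) whenever $x,y\in I$, $x<y$; strictly monotone means one of these. $\mathcal F(I)$ is the class of strictly monotone usc multifunctions $I\to 2^I$. A jump of $F$ is a point $x_0\in I$ with $\#F(x_0)\ge 2$; $J(F)$ is the set of jumps. For $F\in\mathcal F(I)$ with finitely many jumps, the intensity $\zeta(F)$ is the least integer $k\ge 0$ with $\#J(F^k)=\#J(F^{k+1})$ (and $+\infty$ if there is none). $\mathcal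 F_1(I)$ (exclusive multifunctions) is the set of $F\in\mathcal F(I)$ with finitely many jumps and $\zeta(F)=1$. For $F\in\mathcal F_1(I)$ write $J(F)=\{c_1,\dots,c_m\}$ with the standing convention $a=:c_0<c_1<\dots<c_m<c_{m+1}:=b$, put $I_i:=(c_i,c_{i+1})$ and $I(F):=\{I_i: i=0,\dots,m\}$. For strictly increasing $F\in\mathcal F_1(I)$, $\Lambda(F)$ is the set of all $J\in I(F)$ with $F(J)\subset J$. (The interval $K$ in the statement is called an absorbing interval of $F$.) *)

theory Defs
  imports Complex_Main "HOL-Library.Extended_Nat" "HOL-Library.FuncSet"
begin

text \<open>A multifunction on \<open>I\<close> is a function \<open>real \<Rightarrow> real set\<close> of which only the values on
  \<open>I\<close> matter; every notion below looks at those values only.\<close>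

definition multifunction_on :: "real set \<Rightarrow> (real \<Rightarrow> real set) \<Rightarrow> bool" where
  "multifunction_on I F \<longleftrightarrow> (\<forall>x\<in>I. F x \<noteq> {} \<and> F x \<subseteq> I)"

definition mf_image :: "(real \<Rightarrow> real set) \<Rightarrow> real set \<Rightarrow> real set" where
  "mf_image F A = (\<Union>x\<in>A. F x)"

definition mf_comp :: "(real \<Rightarrow> real set) \<Rightarrow> (real \<Rightarrow> real set) \<Rightarrow> real \<Rightarrow> real set" where
  "mf_comp G F = (\<lambda>x. mf_image G (F x))"

primrec mf_pow :: "(real \<Rightarrow> real set) \<Rightarrow> nat \<Rightarrow> real \<Rightarrow> real set" where
  "mf_pow F 0 = (\<lambda>x. {x})"
| "mf_pow F (Suc n) = mf_comp F (mf_pow F n)"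

definition usc_on :: "real set \<Rightarrow> (real \<Rightarrow> real set) \<Rightarrow> bool" where
  "usc_on I F \<longleftrightarrow>
     (\<forall>x0\<in>I. \<forall>V. open V \<and> F x0 \<subseteq> V \<longrightarrow>
        (\<exists>U. open U \<and> x0 \<in> U \<and> (\<forall>x\<in>U \<inter> I. F x \<subseteq> V)))"

definition is_max :: "real set \<Rightarrow> real \<Rightarrow> bool" where
  "is_max A M \<longleftrightarrow> M \<in> A \<and> (\<forall>u\<in>A. u \<le> M)"

definition is_min :: "real set \<Rightarrow> real \<Rightarrow> bool" where
  "is_min A M \<longleftrightarrow> M \<in> A \<and> (\<forall>u\<in>A. M \<le> u)"

text \<open>Values need not be finite or closed, so the inequalities between maxima and minima are
  read as including the existence of the maxima and minima they mention.\<close>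

definition strictly_increasing_on :: "real set \<Rightarrow> (real \<Rightarrow> real set) \<Rightarrow> bool" where
  "strictly_increasing_on I F \<longleftrightarrow>
     (\<forall>x\<in>I. \<forall>y\<in>I. x < y \<longrightarrow> (\<exists>M N. is_max (F x) M \<and> is_min (F y) N \<and> M < N))"

definition strictly_decreasing_on :: "real set \<Rightarrow> (real \<Rightarrow> real set) \<Rightarrow> bool" where
  "strictly_decreasing_on I F \<longleftrightarrow>
     (\<forall>x\<in>I. \<forall>y\<in>I. x < y \<longrightarrow> (\<exists>M N. is_min (F x) M \<and> is_max (F y) N \<and> M > N))"

definition strictly_monotone_usc :: "real set \<Rightarrow> (real \<Rightarrow> real set) set" where
  "strictly_monotone_usc I =
     {F. multifunction_on I F \<and> usc_on I F \<and>
         (strictly_increasing_on I F \<or> strictly_decreasing_on I F)}"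

text \<open>\<^const>\<open>card\<close> is \<open>0\<close> on infinite sets, hence the first disjunct.\<close>

definition jumps :: "real set \<Rightarrow> (real \<Rightarrow> real set) \<Rightarrow> real set" where
  "jumps I F = {x \<in> I. infinite (F x) \<or> card (F x) \<ge> 2}"

text \<open>The infimum in \<^typ>\<open>enat\<close> is the least element of a nonempty set and \<open>\<infinity>\<close> for the empty
  set. The intensity is only used for strictly monotone \<open>F\<close> with finitely many jumps; all
  iterates of such an \<open>F\<close> have finitely many jumps, so \<^const>\<open>card\<close> is the true cardinality.\<close>

definition intensity :: "real set \<Rightarrow> (real \<Rightarrow> real set) \<Rightarrow> enat" where
  "intensity I F =
     Inf (enat ` {k. card (jumps I (mf_pow F k)) = card (jumps I (mf_pow F (Suc k)))})"

definition exclusive :: "real set \<Rightarrow> (real \<Rightarrow> real set) set" where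
  "exclusive I = {F \<in> strictly_monotone_usc I. finite (jumps I F) \<and> intensity I F = 1}"

text \<open>\<open>c 1 < \<dots> < c m\<close> are the jumps of \<open>F\<close> on \<open>[a,b]\<close>, with \<open>c 0 = a\<close> and \<open>c (m + 1) = b\<close>. The
  strict inequalities force all jumps to lie in the open interval \<open>(a,b)\<close>.\<close>

definition jump_enumeration ::
  "real \<Rightarrow> real \<Rightarrow> (real \<Rightarrow> real set) \<Rightarrow> nat \<Rightarrow> (nat \<Rightarrow> real) \<Rightarrow> bool" where
  "jump_enumeration a b F m c \<longleftrightarrow>
     c 0 = a \<and> c (Suc m) = b \<and> (\<forall>i\<in>{0..m}. c i < c (Suc i)) \<and> jumps {a..b} F = c ` {1..m}"

definition jump_interval :: "(nat \<Rightarrow> real) \<Rightarrow> nat \<Rightarrow> real set" where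
  "jump_interval c i = {c i <..< c (Suc i)}"

definition invariant_intervals ::
  "(real \<Rightarrow> real set) \<Rightarrow> nat \<Rightarrow> (nat \<Rightarrow> real) \<Rightarrow> real set set" where
  "invariant_intervals F m c = {J \<in> jump_interval c ` {0..m}. mf_image F J \<subseteq> J}"

end

theory Submission
  imports Defs
begin

text \<open>Intensity 1 says that \<open>F\<close> and \<open>F\<^sup>2\<close> have the same jumps, so a point that is not a jump is
  never mapped to a jump. On each \<open>I\<^sub>i\<close> the multifunction is a continuous function, hence
  \<open>F(I\<^sub>i)\<close> is connected and misses all jumps and both endpoints: it lies in a single
  \<open>I\<^bsub>s(i)\<^esub>\<close>. The index map \<open>s\<close> is nondecreasing on \<open>{0,\<dots>,m}\<close>, so the orbit of \<open>i\<close> under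
  \<open>s\<close> is monotone and consists of distinct indices until it reaches a fixed point of \<open>s\<close>, which it
  does after at most \<open>m\<close> steps.\<close>

section \<open>Images of sets under iterates\<close>

lemma mf_image_pow_Suc:
  "mf_image (mf_pow F (Suc n)) A = mf_image F (mf_image (mf_pow F n) A)"
  by (simp add: mf_image_def mf_comp_def)

lemma mf_image_mono: "A \<subseteq> B \<Longrightarrow> mf_image F A \<subseteq> mf_image F B"
  by (auto simp: mf_image_def)

text \<open>Nonemptiness is what later turns disjointness from an interval \<open>K\<close> into
  failure of inclusion in \<open>K\<close>, as (ii) requires.\<close>

lemma mf_image_pow_nonempty:
  assumes "multifunction_on I F" and "A \<noteq> {}" and "A \<subseteq> I"
  shows "mf_image (mf_pow F n) A \<noteq> {} \<and> mf_image (mf_pow F n) A \<subseteq> I"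
proof (induction n)
  case 0
  then show ?case using assms by (auto simp: mf_image_def)
next
  case (Suc n)
  have "mf_image F B \<noteq> {} \<and> mf_image F B \<subseteq> I" if "B \<noteq> {} \<and> B \<subseteq> I" for B
    using that assms(1) unfolding mf_image_def multifunction_on_def by blast
  then show ?case using Suc unfolding mf_image_pow_Suc by blast
qed

section \<open>Jumps and intensity\<close>

lemma not_jump_singleton:
  assumes "multifunction_on I F" and "x \<in> I" and "x \<notin> jumps I F"
  obtains y where "F x = {y}" and "y \<in> I"
proof -
  have "F x \<noteq> {}" "F x \<subseteq> I" "finite (F x)" "card (F x) < 2"
    using assms by (auto simp: multifunction_on_def jumps_def)
  then have "card (F x) = 1"
    by (metis One_nat_def card_gt_0_iff less_2_cases_iff less_numeral_extra(3))
  then show ?thesis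
    using \<open>F x \<subseteq> I\<close> that by (auto simp: card_1_singleton_iff)
qed

text \<open>Strict monotonicity makes the values of \<open>F\<close> at distinct points disjoint, so
  two points of \<open>F x\<close> produce two distinct points of \<open>F (F x)\<close>.\<close>

lemma jumps_subset_jumps_pow_2:
  assumes "multifunction_on I F" and "strictly_increasing_on I F \<or> strictly_decreasing_on I F"
  shows "jumps I F \<subseteq> jumps I (mf_pow F 2)"
proof
  fix x assume x: "x \<in> jumps I F"
  then have xI: "x \<in> I" by (simp add: jumps_def)
  have "\<exists>u\<in>F x. \<exists>v\<in>F x. u \<noteq> v"
  proof (rule ccontr)
    assume "\<not> ?thesis"
    moreover have "F x \<noteq> {}" using assms(1) xI by (simp add: multifunction_on_def)
    ultimately obtain u where "F x = {u}" by blast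
    then show False using x by (simp add: jumps_def)
  qed
  then obtain u v where uv: "u \<in> F x" "v \<in> F x" "u < v" by (meson linorder_neqE)
  then have I: "u \<in> I" "v \<in> I" using assms(1) xI by (auto simp: multifunction_on_def)
  then obtain r s where rs: "r \<in> F u" "s \<in> F v" "r \<noteq> s"
    using assms(2) uv(3)
    unfolding strictly_increasing_on_def strictly_decreasing_on_def is_max_def is_min_def
    by (metis less_irrefl)
  let ?G = "mf_pow F 2 x"
  have sub: "{r, s} \<subseteq> ?G"
    using rs uv by (auto simp: numeral_2_eq_2 mf_comp_def mf_image_def)
  have "card ?G \<ge> 2" if "finite ?G"
    using card_mono[OF that sub] rs(3) by simp
  then show "x \<in> jumps I (mf_pow F 2)"
    using xI by (auto simp: jumps_def)
qed

text \<open>The intensity compares cardinalities only. Equality of the jump sets follows because one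
  finite set contains the other and both have the same size. A jump exists because
  \<open>F^0\<close> has none and the intensity is not 0.\<close>

lemma exclusive_jumps_pow_2:
  assumes "F \<in> exclusive I"
  shows "jumps I F \<noteq> {}" and "jumps I (mf_pow F 2) = jumps I F"
proof -
  define S where "S = {k. card (jumps I (mf_pow F k)) = card (jumps I (mf_pow F (Suc k)))}"
  have Inf: "Inf (enat ` S) = enat 1"
    and mf: "multifunction_on I F"
    and mono: "strictly_increasing_on I F \<or> strictly_decreasing_on I F"
    using assms unfolding exclusive_def intensity_def strictly_monotone_usc_def one_enat_def S_def
    by blast+
  \<comment> \<open>The infimum of the empty set is \<infinity>, not 1, so \<open>S\<close> is
    nonempty and its infimum is attained.\<close>
  have "enat ` S \<noteq> {}" using Inf by (metis Inf_empty enat.distinct(1) top_enat_def)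
  then have "Inf (enat ` S) \<in> enat ` S"
    unfolding Inf_enat_def by (simp only: if_False) (metis LeastI_ex ex_in_conv)
  then have 1: "1 \<in> S" using Inf by auto
  have 0: "0 \<notin> S"
  proof
    assume "0 \<in> S"
    then have "Inf (enat ` S) \<le> enat 0" by (intro Inf_lower imageI)
    then show False using Inf by simp
  qed
  have pow1: "mf_pow F (Suc 0) = F"
    by (auto simp: mf_comp_def mf_image_def fun_eq_iff)
  have "jumps I (mf_pow F 0) = {}" by (simp add: jumps_def)
  then have pos: "card (jumps I F) \<noteq> 0" using 0 pow1 by (simp add: S_def)
  then show "jumps I F \<noteq> {}" by auto
  have eq: "card (jumps I F) = card (jumps I (mf_pow F 2))"
    using 1 pow1 by (simp add: S_def numeral_2_eq_2)
  \<comment> \<open>\<open>card\<close> vanishes on infinite sets, so a nonzero value certifies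
    finiteness.\<close>
  then have "finite (jumps I (mf_pow F 2))" using pos by (metis card.infinite)
  then show "jumps I (mf_pow F 2) = jumps I F"
    using card_subset_eq[OF _ jumps_subset_jumps_pow_2[OF mf mono] eq] by simp
qed

text \<open>If \<open>F x = {y}\<close>, then \<open>F^2\<close> takes the value \<open>F y\<close>
  at \<open>x\<close>; a jump at \<open>y\<close> would make \<open>x\<close> a jump of
  \<open>F^2\<close> and hence of \<open>F\<close>.\<close>

lemma exclusive_image_not_jump:
  assumes "F \<in> exclusive I" and "x \<in> I" and "x \<notin> jumps I F" and "y \<in> F x"
  shows "y \<notin> jumps I F"
proof
  assume y: "y \<in> jumps I F"
  have "multifunction_on I F"
    using assms(1) by (simp add: exclusive_def strictly_monotone_usc_def)
  then have "F x = {y}"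
    using not_jump_singleton[of I F x] assms by (metis singletonD)
  then have "mf_pow F 2 x = F y"
    by (auto simp: numeral_2_eq_2 mf_comp_def mf_image_def)
  then have "x \<in> jumps I (mf_pow F 2)"
    using y assms(2) by (auto simp: jumps_def)
  then show False
    using assms(3) exclusive_jumps_pow_2(2)[OF assms(1)] by simp
qed

section \<open>Continuity off the jumps and behaviour at the endpoints\<close>

lemma connected_mf_image:
  assumes "usc_on I F" and "A \<subseteq> I" and "connected A" and "\<And>x. x \<in> A \<Longrightarrow> \<exists>y. F x = {y}"
  shows "connected (mf_image F A)"
proof -
  define f where "f x = the_elem (F x)" for x
  have f: "F x = {f x}" if "x \<in> A" for x
    using assms(4)[OF that] unfolding f_def by (metis the_elem_eq)
  \<comment> \<open>For a single-valued multifunction, upper semi-continuity is ordinary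
    continuity.\<close>
  have "continuous_on A f"
    unfolding continuous_on_topological
  proof (intro ballI allI impI)
    fix x B assume "x \<in> A" "open B" "f x \<in> B"
    then have "x \<in> I" "F x \<subseteq> B" using assms(2) f by auto
    then obtain U where "open U" "x \<in> U" "\<forall>y\<in>U \<inter> I. F y \<subseteq> B"
      using assms(1) \<open>open B\<close> unfolding usc_on_def by metis
    moreover have "f y \<in> B" if "y \<in> A" "y \<in> U" for y
      using \<open>\<forall>y\<in>U \<inter> I. F y \<subseteq> B\<close> assms(2) f[OF that(1)] that by blast
    ultimately show "\<exists>U. open U \<and> x \<in> U \<and> (\<forall>y\<in>A. y \<in> U \<longrightarrow> f y \<in> B)"
      by blast
  qed
  then have "connected (f ` A)" using assms(3) by (rule connected_continuous_image)
  moreover have "mf_image F A = f ` A" using f by (auto simp: mf_image_def)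
  ultimately show ?thesis by simp
qed

lemma strictly_increasing_onD:
  assumes "strictly_increasing_on I F" and "x \<in> I" and "y \<in> I" and "x < y"
    and "u \<in> F x" and "v \<in> F y"
  shows "u < v"
proof -
  obtain M N where "is_max (F x) M" "is_min (F y) N" "M < N"
    using assms unfolding strictly_increasing_on_def by blast
  then have "u \<le> M" "N \<le> v" using assms by (auto simp: is_max_def is_min_def)
  then show ?thesis using \<open>M < N\<close> by simp
qed

text \<open>Any value at an interior point lies strictly between some value at \<open>a\<close> and
  some value at \<open>b\<close>, and those already lie in \<open>[a,b]\<close>.\<close>

lemma mf_image_open_subset:
  assumes "multifunction_on {a..b} F" and "strictly_increasing_on {a..b} F" and "a < b"
  shows "mf_image F {a<..<b} \<subseteq> {a<..<b}"
proof
  fix y assume "y \<in> mf_image F {a<..<b}"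
  then obtain x where x: "a < x" "x < b" "y \<in> F x" by (auto simp: mf_image_def)
  have "F a \<noteq> {}" "F a \<subseteq> {a..b}" "F b \<noteq> {}" "F b \<subseteq> {a..b}"
    using assms(1,3) by (auto simp: multifunction_on_def)
  then obtain u v where uv: "u \<in> F a" "v \<in> F b" "a \<le> u" "v \<le> b" by fastforce
  have "u < y" "y < v"
    using strictly_increasing_onD[OF assms(2), of a x u y]
      strictly_increasing_onD[OF assms(2), of x b y v] x uv assms(3) by auto
  then show "y \<in> {a<..<b}" using uv by auto
qed

section \<open>The intervals between consecutive jumps\<close>

lemma jump_enumeration_mono:
  assumes "jump_enumeration a b F m c" and "i \<le> j" and "j \<le> Suc m"
  shows "c i \<le> c j"
  using assms(2,3)
proof (induction j rule: dec_induct)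
  case (step n)
  then have "c n < c (Suc n)" using assms(1) by (auto simp: jump_enumeration_def)
  then show ?case using step by auto
qed simp

lemma jump_interval_less:
  assumes "jump_enumeration a b F m c" and "i < j" and "j \<le> m"
    and "x \<in> jump_interval c i" and "y \<in> jump_interval c j"
  shows "x < y"
  using jump_enumeration_mono[OF assms(1), of "Suc i" j] assms(2-)
  by (auto simp: jump_interval_def)

lemma jump_intervals_disjoint:
  assumes "jump_enumeration a b F m c" and "i \<le> m" and "j \<le> m" and "i \<noteq> j"
  shows "jump_interval c i \<inter> jump_interval c j = {}"
proof -
  have False if "x \<in> jump_interval c i" "x \<in> jump_interval c j" for x
    using jump_interval_less[OF assms(1), of i j x x] jump_interval_less[OF assms(1), of j i x x]
      that assms(2-) by linarith
  then show ?thesis by blast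
qed

lemma jump_interval_nonempty:
  assumes "jump_enumeration a b F m c" and "i \<le> m"
  shows "jump_interval c i \<noteq> {}"
  using assms dense[of "c i" "c (Suc i)"] by (auto simp: jump_interval_def jump_enumeration_def)

lemma jump_interval_subset:
  assumes "jump_enumeration a b F m c" and "i \<le> m"
  shows "jump_interval c i \<subseteq> {a<..<b}"
  using jump_enumeration_mono[OF assms(1), of 0 i] assms
    jump_enumeration_mono[OF assms(1), of "Suc i" "Suc m"]
  by (auto simp: jump_interval_def jump_enumeration_def)

lemma jump_interval_no_jump:
  assumes "jump_enumeration a b F m c" and "i \<le> m" and "x \<in> jump_interval c i"
  shows "x \<notin> jumps {a..b} F"
proof
  assume "x \<in> jumps {a..b} F"
  then obtain j where j: "x = c j" "j \<le> m" "1 \<le> j"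
    using assms(1) by (auto simp: jump_enumeration_def)
  show False
  proof (cases "j \<le> i")
    case True
    then show False
      using jump_enumeration_mono[OF assms(1), of j i] assms j by (auto simp: jump_interval_def)
  next
    case False
    then show False
      using jump_enumeration_mono[OF assms(1), of "Suc i" j] assms j by (auto simp: jump_interval_def)
  qed
qed

lemma jump_interval_endpoint:
  assumes "jump_enumeration a b F m c" and "j \<le> Suc m"
  shows "c j \<in> {a, b} \<union> jumps {a..b} F"
proof -
  consider "j = 0" | "j = Suc m" | "j \<in> {1..m}" using assms(2) by fastforce
  then show ?thesis using assms(1) by cases (auto simp: jump_enumeration_def)
qed

text \<open>The set misses every \<open>c j\<close>, endpoints included, and a connected set with
  points on both sides of \<open>c j\<close> would contain \<open>c j\<close>. Hence the interval
  around any one of its points contains all of it.\<close>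

lemma connected_subset_jump_interval:
  assumes "jump_enumeration a b F m c"
    and "connected S" and "S \<noteq> {}" and "S \<subseteq> {a<..<b}" and "S \<inter> jumps {a..b} F = {}"
  shows "\<exists>j\<le>m. S \<subseteq> jump_interval c j"
proof -
  have notin: "c j \<notin> S" if "j \<le> Suc m" for j
    using jump_interval_endpoint[OF assms(1) that] assms(4,5) by auto
  obtain y where y: "y \<in> S" using assms(3) by blast
  \<comment> \<open>The right end of the interval around \<open>y\<close>: such an index exists
    because \<open>y < b\<close>, and it is not 0 because \<open>a < y\<close>, so its predecessor
    \<open>j\<close> gives the left end.\<close>
  define n where "n = (LEAST n. y < c n)"
  have last: "y < c (Suc m)" and first: "c 0 < y"
    using assms(1,4) y by (auto simp: jump_enumeration_def)
  have n: "y < c n" "n \<le> Suc m"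
    unfolding n_def using last by (auto intro: LeastI Least_le)
  then obtain j where j: "n = Suc j" using first by (cases n) auto
  have "\<not> y < c j"
    using not_less_Least[of j "\<lambda>n. y < c n"] j by (simp add: n_def)
  then have cj: "c j < y" using notin[of j] n(2) j y by (metis Suc_leD linorder_neqE)
  have "z \<in> jump_interval c j" if z: "z \<in> S" for z
  proof -
    have "c j < z"
      using connectedD_interval[OF assms(2) z y, of "c j"] notin[of j] cj n(2) j by force
    moreover have "z < c (Suc j)"
      using connectedD_interval[OF assms(2) y z, of "c n"] notin[of n] n j by force
    ultimately show ?thesis by (simp add: jump_interval_def)
  qed
  then show ?thesis using n(2) j by blast
qed

section \<open>The index map induced by \<open>F\<close>\<close>

lemma jump_interval_image:
  assumes "a < b" and "F \<in> exclusive {a..b}" and "strictly_increasing_on {a..b} F"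
    and "jump_enumeration a b F m c" and "i \<le> m"
  shows "\<exists>j\<le>m. mf_image F (jump_interval c i) \<subseteq> jump_interval c j"
proof (rule connected_subset_jump_interval[OF assms(4)])
  let ?A = "jump_interval c i"
  have mf: "multifunction_on {a..b} F" and usc: "usc_on {a..b} F"
    using assms(2) by (auto simp: exclusive_def strictly_monotone_usc_def)
  have sub: "?A \<subseteq> {a<..<b}" by (rule jump_interval_subset[OF assms(4,5)])
  then have sub': "?A \<subseteq> {a..b}" by auto
  have nj: "x \<notin> jumps {a..b} F" if "x \<in> ?A" for x
    using jump_interval_no_jump[OF assms(4,5) that] .
  show "connected (mf_image F ?A)"
  proof (rule connected_mf_image[OF usc sub'])
    show "connected ?A" by (simp add: jump_interval_def connected_Ioo)
    show "\<exists>y. F x = {y}" if "x \<in> ?A" for x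
      using not_jump_singleton[OF mf _ nj[OF that]] sub' that by blast
  qed
  show "mf_image F ?A \<noteq> {}"
    using mf jump_interval_nonempty[OF assms(4,5)] sub'
    by (fastforce simp: mf_image_def multifunction_on_def)
  show "mf_image F ?A \<subseteq> {a<..<b}"
    using mf_image_open_subset[OF mf assms(3,1)] mf_image_mono[OF sub] by blast
  \<comment> \<open>Intensity 1 enters here: it keeps the image from crossing a jump and spreading
    over several intervals.\<close>
  show "mf_image F ?A \<inter> jumps {a..b} F = {}"
    using exclusive_image_not_jump[OF assms(2) _ nj] sub' unfolding mf_image_def by blast
qed

text \<open>If the target intervals came in the reverse order, points \<open>x < y\<close> of the
  source intervals would have values in the reverse order, against strict increase.\<close>

lemma image_index_mono:
  assumes "multifunction_on {a..b} F" and "strictly_increasing_on {a..b} F"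
    and "jump_enumeration a b F m c"
    and s: "\<And>i. i \<le> m \<Longrightarrow> s i \<le> m \<and> mf_image F (jump_interval c i) \<subseteq> jump_interval c (s i)"
    and "i \<le> j" and "j \<le> m"
  shows "s i \<le> s j"
proof (rule ccontr)
  assume less: "\<not> s i \<le> s j"
  then have ij: "i < j" using assms(5) by (cases "i = j") auto
  then have "i \<le> m" using assms(6) by simp
  obtain x y where xy: "x \<in> jump_interval c i" "y \<in> jump_interval c j"
    using jump_interval_nonempty[OF assms(3) \<open>i \<le> m\<close>] jump_interval_nonempty[OF assms(3,6)]
    by blast
  then have "x < y" using jump_interval_less[OF assms(3) ij assms(6)] by blast
  have I: "x \<in> {a..b}" "y \<in> {a..b}"
    using jump_interval_subset[OF assms(3)] \<open>i \<le> m\<close> assms(6) xy by fastforce+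
  then obtain u v where uv: "u \<in> F x" "v \<in> F y"
    using assms(1) unfolding multifunction_on_def by blast
  then have "u < v" using strictly_increasing_onD[OF assms(2) I \<open>x < y\<close>] by blast
  moreover have "u \<in> jump_interval c (s i)" "v \<in> jump_interval c (s j)"
    using s[OF \<open>i \<le> m\<close>] s[OF assms(6)] xy uv by (auto simp: mf_image_def)
  then have "v < u"
    using jump_interval_less[OF assms(3), of "s j" "s i"] less s[OF \<open>i \<le> m\<close>] by auto
  ultimately show False by simp
qed

section \<open>Orbits of a nondecreasing index map\<close>

lemma mono_index_orbit:
  fixes s :: "nat \<Rightarrow> nat"
  assumes "m \<ge> 1" and "i \<le> m" and s: "\<And>i. i \<le> m \<Longrightarrow> s i \<le> m"
    and mono: "\<And>i j. i \<le> j \<Longrightarrow> j \<le> m \<Longrightarrow> s i \<le> s j"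
  obtains k where "k \<in> {1..m}" and "s ((s ^^ k) i) = (s ^^ k) i"
    and "inj_on (\<lambda>n. (s ^^ n) i) {1..k}"
proof -
  let ?t = "\<lambda>n. (s ^^ n) i"
  have tm: "?t n \<le> m" for n by (induction n) (use assms(2) s in auto)
  \<comment> \<open>Since \<open>s\<close> is nondecreasing, the comparison between \<open>i\<close>
    and \<open>s i\<close> propagates along the whole orbit.\<close>
  have t_mono: "(\<forall>p q. p \<le> q \<longrightarrow> ?t p \<le> ?t q) \<or> (\<forall>p q. p \<le> q \<longrightarrow> ?t q \<le> ?t p)"
  proof (cases "i \<le> s i")
    case True
    have "?t n \<le> ?t (Suc n)" for n
      by (induction n) (use True mono tm in \<open>simp_all, metis funpow.simps(2) comp_apply\<close>)
    then show ?thesis by (intro disjI1) (simp add: lift_Suc_mono_le[of ?t])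
  next
    case False
    have "?t (Suc n) \<le> ?t n" for n
      by (induction n) (use False mono tm in auto)
    then show ?thesis by (intro disjI2) (simp add: lift_Suc_antimono_le[of ?t])
  qed
  \<comment> \<open>In a monotone sequence, equal terms at \<open>p < q\<close> squeeze the term at
    \<open>Suc p\<close> to the same value, so a repetition needs a stationary step at
    \<open>p\<close>.\<close>
  have inj: "inj_on ?t {..N}" if N: "\<And>n. n < N \<Longrightarrow> ?t (Suc n) \<noteq> ?t n" for N
  proof (rule linorder_inj_onI)
    fix p q assume pq: "p < q" "p \<in> {..N}" "q \<in> {..N}"
    then have "p \<le> Suc p" "Suc p \<le> q" "p < N" by auto
    then show "?t p \<noteq> ?t q" using t_mono N[of p] by (metis le_antisym)
  qed auto
  \<comment> \<open>Pigeonhole: the \<open>N + 1\<close> distinct terms all lie among the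
    \<open>m + 1\<close> indices up to \<open>m\<close>.\<close>
  have bound: "N \<le> m" if N: "\<And>n. n < N \<Longrightarrow> ?t (Suc n) \<noteq> ?t n" for N
  proof -
    have "card {..N} \<le> card {..m}"
      by (rule card_inj_on_le[OF inj]) (use N tm in auto)
    then show ?thesis by simp
  qed
  define r where "r = (LEAST n. ?t (Suc n) = ?t n)"
  have "\<exists>n. ?t (Suc n) = ?t n" using bound[of "Suc m"] by force
  then have fix_r: "?t (Suc r) = ?t r" unfolding r_def by (rule LeastI_ex)
  have less_r: "?t (Suc n) \<noteq> ?t n" if "n < r" for n
    using not_less_Least[OF that[unfolded r_def]] .
  show thesis
  \<comment> \<open>The exponent must be at least 1, so when \<open>i\<close> itself is fixed the
    choice is \<open>k = 1\<close>. The terms at 0 and 1 then coincide, which is why injectivity is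
    claimed from 1 on only.\<close>
  proof (cases "r = 0")
    case True
    then show thesis using that[of 1] fix_r assms(1) by simp
  next
    case False
    have "inj_on ?t {1..r}"
      by (rule inj_on_subset[OF inj[OF less_r]]) auto
    then show thesis using that[of r] fix_r False bound[OF less_r] by simp
  qed
qed

section \<open>Absorbing intervals and the map \<open>\<kappa>\<close>\<close>

theorem lemma2p6:
  fixes a b :: real and F :: "real \<Rightarrow> real set" and m :: nat and c :: "nat \<Rightarrow> real"
  assumes "a < b"
    and "F \<in> exclusive {a..b}"
    and "strictly_increasing_on {a..b} F"
    and "jump_enumeration a b F m c"
  shows "\<exists>\<kappa> :: nat \<Rightarrow> nat. \<kappa> \<in> {0..m} \<rightarrow> {1..m} \<and>
    (\<forall>i\<in>{0..m}. \<exists>K\<in>invariant_intervals F m c.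
       mf_image (mf_pow F (\<kappa> i)) (jump_interval c i) \<subseteq> K \<and>
       (\<forall>k\<in>{1..\<kappa> i - 1}. \<not> mf_image (mf_pow F k) (jump_interval c i) \<subseteq> K) \<and>
       (\<forall>p\<in>{1..\<kappa> i}. \<forall>q\<in>{1..\<kappa> i}. p \<noteq> q \<longrightarrow>
          mf_image (mf_pow F p) (jump_interval c i) \<inter> mf_image (mf_pow F q) (jump_interval c i) = {}))"
proof -
  have mf: "multifunction_on {a..b} F"
    using assms(2) by (auto simp: exclusive_def strictly_monotone_usc_def)
  have "jumps {a..b} F = c ` {1..m}" using assms(4) by (simp add: jump_enumeration_def)
  \<comment> \<open>At least one jump is needed for the range \<open>{1..m}\<close> of
    \<open>\<kappa>\<close> to be nonempty.\<close>
  then have m: "m \<ge> 1" using exclusive_jumps_pow_2(1)[OF assms(2)] by (cases m) auto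
  obtain s where s: "\<And>i. i \<le> m \<Longrightarrow>
      s i \<le> m \<and> mf_image F (jump_interval c i) \<subseteq> jump_interval c (s i)"
    using jump_interval_image[OF assms] by metis
  have orbit: "(s ^^ n) i \<le> m \<and>
      mf_image (mf_pow F n) (jump_interval c i) \<subseteq> jump_interval c ((s ^^ n) i)"
    if "i \<le> m" for i n
  proof (induction n)
    case 0
    then show ?case using that by (auto simp: mf_image_def)
  next
    case (Suc n)
    then show ?case
      using s mf_image_mono unfolding mf_image_pow_Suc by (metis comp_apply funpow.simps(2) order_trans)
  qed
  define P where "P i k \<longleftrightarrow> (\<exists>K\<in>invariant_intervals F m c.
       mf_image (mf_pow F k) (jump_interval c i) \<subseteq> K \<and>
       (\<forall>n\<in>{1..k - 1}. \<not> mf_image (mf_pow F n) (jump_interval c i) \<subseteq> K) \<and>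
       (\<forall>p\<in>{1..k}. \<forall>q\<in>{1..k}. p \<noteq> q \<longrightarrow>
          mf_image (mf_pow F p) (jump_interval c i) \<inter> mf_image (mf_pow F q) (jump_interval c i) = {}))"
    for i k
  have "\<exists>k\<in>{1..m}. P i k"
    if i: "i \<in> {0..m}" for i
  proof -
    let ?A = "\<lambda>n. mf_image (mf_pow F n) (jump_interval c i)"
    have im: "i \<le> m" using i by simp
    obtain k where k: "k \<in> {1..m}" and fixed: "s ((s ^^ k) i) = (s ^^ k) i"
      and inj: "inj_on (\<lambda>n. (s ^^ n) i) {1..k}"
      using mono_index_orbit[OF m im, of s] s image_index_mono[OF mf assms(3,4) s] by metis
    \<comment> \<open>The absorbing interval is the one at which the index orbit becomes stationary;
      \<open>fixed\<close> makes it invariant.\<close>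
    let ?K = "jump_interval c ((s ^^ k) i)"
    \<comment> \<open>Distinct indices along the orbit mean disjoint intervals. Taking
      \<open>q = k\<close> yields (ii), and shrinking the second interval to \<open>?A q\<close>
      yields (iii).\<close>
    have disjoint: "?A p \<inter> jump_interval c ((s ^^ q) i) = {}"
      if "p \<in> {1..k}" "q \<in> {1..k}" "p \<noteq> q" for p q
      using jump_intervals_disjoint[OF assms(4), of "(s ^^ p) i" "(s ^^ q) i"]
        orbit[OF im, of p] orbit[OF im, of q] inj_onD[OF inj] that by blast
    have "?K \<in> invariant_intervals F m c"
      using orbit[OF im, of k] s[of "(s ^^ k) i"] fixed by (auto simp: invariant_intervals_def)
    moreover have "?A k \<subseteq> ?K" using orbit[OF im] by blast
    moreover have "\<not> ?A n \<subseteq> ?K" if "n \<in> {1..k - 1}" for n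
    proof -
      have "n \<in> {1..k}" "k \<in> {1..k}" "n \<noteq> k" using that k by auto
      then have "?A n \<inter> ?K = {}" by (rule disjoint)
      moreover have "jump_interval c i \<subseteq> {a..b}"
        using jump_interval_subset[OF assms(4) im] by auto
      then have "?A n \<noteq> {}"
        using mf_image_pow_nonempty[OF mf jump_interval_nonempty[OF assms(4) im]] by blast
      ultimately show ?thesis by blast
    qed
    moreover have "?A p \<inter> ?A q = {}" if "p \<in> {1..k}" "q \<in> {1..k}" "p \<noteq> q" for p q
      using disjoint[OF that] orbit[OF im, of q] by blast
    ultimately show ?thesis unfolding P_def using k by blast
  qed
  then have "\<forall>i\<in>{0..m}. \<exists>k. k \<in> {1..m} \<and> P i k" by blast
  from bchoice[OF this] obtain \<kappa> where "\<forall>i\<in>{0..m}. \<kappa> i \<in> {1..m} \<and> P i (\<kappa> i)" ..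
  then show ?thesis unfolding P_def by (intro exI[of _ \<kappa>] conjI ballI Pi_I) blast+
qed

end
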